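(* Let $L\ge2$ be an integer, $\langle z\rangle:=\sin\big(\frac{\pi z}{L+1}\big)$ and $\bar\kappa^{\mathrm{tri}}=2\cos\frac{\pi}{L+1}$. The function $x=f(z)=\frac{\langle z\rangle}{\langle1-z\rangle}$ satisfies, with $x=f(z)$, $x'=f(z')$, $x''=f(z'')$ and $z''=z'-z$ (for generic $z,z'$), $$x''=\frac{x'-x}{1+\bar\kappa^{\mathrm{tri}}x+xx'}.$$ Consequently $\check R^{\mathrm{tri}}_A(z,a)=\mathrm{id}+\frac{\langle z\rangle}{\langle1-z\rangle}T_A^{\mathrm{tri}}(a)$, where for $a\in\mathbb{Z}+b$ $$T^{\mathrm{tri}}_A(a)=\frac{\sqrt{\langle a-1\rangle\langle a+1\rangle}}{\langle a\rangle}\big(E_{21}\otimes E_{12}+E_{12}\otimes E_{21}\big)+\frac{\langle a+1\rangle}{\langle a\rangle}E_{11}\otimes E_{22}+\frac{\langle a-1\rangle}{\langle a\rangle}E_{22}\otimes E_{11},$$ satisfies the dynamical Yang--Baxter equation: for all $a\in\mathbb{Z}+b$ and generic $z,w\in\mathbb{C}$, $$\check R^{(23)}(z-w,ah^{(1)})\,\check R^{(12)}(z,a)\,\check R^{(23)}(w,ah^{(1)})=\check R^{(12)}(w,a)\,\check R^{(23)}(z,ah^{(1)})\,\check R^{(12)}(z-w,a),$$ with $\check R=\check R_A^{\mathrm{tri}}$.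
   Context: Fix a generic $b\in\mathbb{C}$ (so that $\langle a\rangle\ne0$ for all $a\in\mathbb{Z}+b$). $\pi_A^{\mathrm{unres}}$ is the groupoid of the unoriented graph with vertex set $\mathbb{Z}+b$ and one edge between any two neighbouring numbers: its objects are the vertices, each edge gives two mutually inverse arrows, and all arrows are compositions of these. Write $(a,\pm1)$ for the arrow from $a$ to $a\pm1$. $V=V^{\pi_A^{\mathrm{unres}}}$ is the graded vector space with $V_{(a,-1)}=\mathbb{C}e_{(a,-1)}$, $V_{(a,+1)}=\mathbb{C}e_{(a,+1)}$ for all objects $a$, all other components zero. Tensor products: $(V\otimes W)_\gamma=\bigoplus_{\beta\circ\alpha=\gamma}V_\alpha\otimes W_\beta$ ($\beta\circ\alpha$ defined when $t(\alpha)=s(\beta)$, where $s,t$ denote source and target). For each $a$ the source fiber $\bigoplus_{\alpha\in s^{-1}(a)}(V\otimes V)_\alpha$ is identified with $\mathbb{C}^2\otimes\mathbb{C}^2$ by $e_{(a,\varepsilon_1)}\otimes e_{(a+\varepsilon_1,\varepsilon_2)}\mapsto e_{i_1}\otimes e_{i_2}$, with $i=1$ for $\varepsilon=+1$ and $i=2$ for $\varepsilon=-1$; $E_{ij}$ is the $2\times2$ matrix unit, $E_{ij}e_k=\delta_{jk}e_i$. For a family $X(a)\in\bigoplus_{\alpha\in s^{-1}(a)}\mathrm{End}_{\mathbb{C}}((V\otimes V)_\alpha)$ and $u\otimes v\otimes w\in V_{\alpha_1}\otimes V_{\alpha_2}\otimes V_{\alpha_3}$ with composable arrows and $s(\alpha_1)=a$,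 set $X^{(12)}(a)(u\otimes v\otimes w)=X(a)(u\otimes v)\otimes w$ and $X^{(23)}(ah^{(1)})(u\otimes v\otimes w)=u\otimes X(t(\alpha_1))(v\otimes w)$. *)

theory Defs
  imports "HOL-Analysis.Analysis"
begin

section \<open>The groupoid of the graph on \<open>\<int> + b\<close>\<close>

definition vert :: "complex \<Rightarrow> complex set" where
  "vert b = {of_int n + b | n. True}"

text \<open>A walk is the nonempty list of the vertices it visits, from source to target.\<close>

definition walk :: "complex \<Rightarrow> complex list \<Rightarrow> bool" where
  "walk b p \<longleftrightarrow> p \<noteq> [] \<and> set p \<subseteq> vert b \<and>
     successively (\<lambda>x y. y = x + 1 \<or> y = x - 1) p"

text \<open>
  The two directions of an edge are mutually inverse, so going along an edge and straight back
  may be deleted. Arrows are the classes of walks for the equivalence relation generated by this.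
\<close>

definition backtrack :: "complex \<Rightarrow> complex list \<Rightarrow> complex list \<Rightarrow> bool" where
  "backtrack b p q \<longleftrightarrow> walk b p \<and>
     (\<exists>us x y vs. p = us @ [x, y, x] @ vs \<and> q = us @ [x] @ vs)"

type_synonym arrow = "complex list set"

definition walk_class :: "complex \<Rightarrow> complex list \<Rightarrow> arrow" where
  "walk_class b p = {q. equivclp (backtrack b) p q}"

definition arrows :: "complex \<Rightarrow> arrow set" where
  "arrows b = walk_class b ` {p. walk b p}"

definition src :: "arrow \<Rightarrow> complex" where
  "src \<alpha> = the_elem (hd ` \<alpha>)"

definition tgt :: "arrow \<Rightarrow> complex" where
  "tgt \<alpha> = the_elem (last ` \<alpha>)"

text \<open>
  \<open>arrow_comp b \<beta> \<alpha>\<close> is \<open>\<beta> \<circ> \<alpha>\<close> (first \<open>\<alpha>\<close>, then \<open>\<beta>\<close>); it is meaningful for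
  \<open>tgt \<alpha> = src \<beta>\<close>, and then all sets in the union coincide.
\<close>

definition arrow_comp :: "complex \<Rightarrow> arrow \<Rightarrow> arrow \<Rightarrow> arrow" where
  "arrow_comp b \<beta> \<alpha> = (\<Union>p\<in>\<alpha>. \<Union>q\<in>\<beta>. walk_class b (p @ tl q))"

text \<open>The arrow \<open>(a, \<epsilon>)\<close> from \<open>a\<close> to \<open>a + \<epsilon>\<close>, for \<open>\<epsilon> = 1\<close> or \<open>\<epsilon> = -1\<close>.\<close>

definition step :: "complex \<Rightarrow> complex \<Rightarrow> complex \<Rightarrow> arrow" where
  "step b a \<epsilon> = walk_class b [a, a + \<epsilon>]"


section \<open>Graded vector spaces\<close>

text \<open>
  A graded complex vector space is given by a homogeneous basis: a set of labels and the degree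
  of each label. Its vectors are the finitely supported coefficient functions on the labels.
  The tensor product has the pairs of labels with composable degrees as basis.
\<close>

record 'i graded =
  labels :: "'i set"
  degree_of :: "'i \<Rightarrow> arrow"

definition component :: "'i graded \<Rightarrow> arrow \<Rightarrow> ('i \<Rightarrow> complex) set" where
  "component V \<gamma> = {\<phi>. finite {i. \<phi> i \<noteq> 0} \<and>
     {i. \<phi> i \<noteq> 0} \<subseteq> {i \<in> labels V. degree_of V i = \<gamma>}}"

text \<open>The direct sum of the components of all degrees with source \<open>a\<close>.\<close>

definition source_fiber :: "'i graded \<Rightarrow> complex \<Rightarrow> ('i \<Rightarrow> complex) set" where
  "source_fiber V a = {\<phi>. finite {i. \<phi> i \<noteq> 0} \<and>
     {i. \<phi> i \<noteq> 0} \<subseteq> {i \<in> labels V. src (degree_of V i) = a}}"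

definition graded_tensor :: "complex \<Rightarrow> 'i graded \<Rightarrow> 'j graded \<Rightarrow> ('i \<times> 'j) graded" where
  "graded_tensor b V W =
     \<lparr>labels = {(i, j). i \<in> labels V \<and> j \<in> labels W \<and> tgt (degree_of V i) = src (degree_of W j)},
      degree_of = (\<lambda>(i, j). arrow_comp b (degree_of W j) (degree_of V i))\<rparr>"

definition VA :: "complex \<Rightarrow> arrow graded" where
  "VA b = \<lparr>labels = {step b a \<epsilon> | a \<epsilon>. a \<in> vert b \<and> \<epsilon> \<in> {1, -1}}, degree_of = (\<lambda>\<alpha>. \<alpha>)\<rparr>"

abbreviation VA2 :: "complex \<Rightarrow> (arrow \<times> arrow) graded" where
  "VA2 b \<equiv> graded_tensor b (VA b) (VA b)"

abbreviation VA3 :: "complex \<Rightarrow> (arrow \<times> arrow \<times> arrow) graded" where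
  "VA3 b \<equiv> graded_tensor b (VA b) (VA2 b)"

text \<open>
  Families \<open>X\<close> with \<open>X(a)\<close> in the direct sum of the \<open>End(V\<^sub>\<alpha>)\<close>, \<open>\<alpha>\<close> running over the arrows
  with source \<open>a\<close>. An operator is a map on coefficient functions; only its values on the source
  fiber at \<open>a\<close> matter.
\<close>

definition fiber_End :: "complex \<Rightarrow> 'i graded \<Rightarrow>
    (complex \<Rightarrow> ('i \<Rightarrow> complex) \<Rightarrow> ('i \<Rightarrow> complex)) set" where
  "fiber_End b V = {X. \<forall>a \<in> vert b.
     (\<forall>\<phi> \<in> source_fiber V a. \<forall>\<psi> \<in> source_fiber V a.
        X a (\<lambda>i. \<phi> i + \<psi> i) = (\<lambda>i. X a \<phi> i + X a \<psi> i)) \<and>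
     (\<forall>c. \<forall>\<phi> \<in> source_fiber V a. X a (\<lambda>i. c * \<phi> i) = (\<lambda>i. c * X a \<phi> i)) \<and>
     (\<forall>\<gamma> \<in> arrows b. src \<gamma> = a \<longrightarrow> X a ` component V \<gamma> \<subseteq> component V \<gamma>)}"

text \<open>
  \<open>X\<^sup>(\<^sup>1\<^sup>2\<^sup>)(a)\<close> and \<open>X\<^sup>(\<^sup>2\<^sup>3\<^sup>)(ah\<^sup>(\<^sup>1\<^sup>))\<close>, in coefficients; their values on pure tensors are
  \<open>op12_pure\<close> and \<open>op23_pure\<close> below. In \<open>op23\<close> the dynamical parameter is read off from the
  first tensor factor, so \<open>a\<close> is not an argument.
\<close>

definition op12 :: "(complex \<Rightarrow> (arrow \<times> arrow \<Rightarrow> complex) \<Rightarrow> (arrow \<times> arrow \<Rightarrow> complex)) \<Rightarrow>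
    complex \<Rightarrow> (arrow \<times> arrow \<times> arrow \<Rightarrow> complex) \<Rightarrow> (arrow \<times> arrow \<times> arrow \<Rightarrow> complex)" where
  "op12 X a \<phi> = (\<lambda>(\<alpha>, \<beta>, \<gamma>). X a (\<lambda>(\<alpha>', \<beta>'). \<phi> (\<alpha>', \<beta>', \<gamma>)) (\<alpha>, \<beta>))"

definition op23 :: "(complex \<Rightarrow> (arrow \<times> arrow \<Rightarrow> complex) \<Rightarrow> (arrow \<times> arrow \<Rightarrow> complex)) \<Rightarrow>
    (arrow \<times> arrow \<times> arrow \<Rightarrow> complex) \<Rightarrow> (arrow \<times> arrow \<times> arrow \<Rightarrow> complex)" where
  "op23 X \<phi> = (\<lambda>(\<alpha>, \<beta>, \<gamma>). X (tgt \<alpha>) (\<lambda>(\<beta>', \<gamma>'). \<phi> (\<alpha>, \<beta>', \<gamma>')) (\<beta>, \<gamma>))"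

definition pure_tensor :: "('i \<Rightarrow> complex) \<Rightarrow> ('j \<Rightarrow> complex) \<Rightarrow> 'i \<times> 'j \<Rightarrow> complex" where
  "pure_tensor u v = (\<lambda>(i, j). u i * v j)"

lemma op12_pure:
  assumes "\<And>c \<phi>. X a (\<lambda>i. c * \<phi> i) = (\<lambda>i. c * X a \<phi> i)"
  shows "op12 X a (pure_tensor u (pure_tensor v w)) =
           (\<lambda>(\<alpha>, \<beta>, \<gamma>). pure_tensor (X a (pure_tensor u v)) w ((\<alpha>, \<beta>), \<gamma>))"
proof (rule ext, clarify)
  fix \<alpha> \<beta> \<gamma>
  have "(\<lambda>(\<alpha>', \<beta>'). pure_tensor u (pure_tensor v w) (\<alpha>', \<beta>', \<gamma>)) = (\<lambda>i. w \<gamma> * pure_tensor u v i)"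
    by (auto simp: pure_tensor_def fun_eq_iff)
  then show "op12 X a (pure_tensor u (pure_tensor v w)) (\<alpha>, \<beta>, \<gamma>) =
      pure_tensor (X a (pure_tensor u v)) w ((\<alpha>, \<beta>), \<gamma>)"
    using assms[of "w \<gamma>" "pure_tensor u v"] by (simp add: op12_def) (simp add: pure_tensor_def)
qed

lemma op23_pure:
  assumes "\<And>a c \<phi>. X a (\<lambda>i. c * \<phi> i) = (\<lambda>i. c * X a \<phi> i)"
    and "u \<in> component (VA b) \<alpha>\<^sub>1"
  shows "op23 X (pure_tensor u (pure_tensor v w)) =
           pure_tensor u (X (tgt \<alpha>\<^sub>1) (pure_tensor v w))"
proof (rule ext, clarify)
  fix \<alpha> \<beta> \<gamma>
  have "(\<lambda>(\<beta>', \<gamma>'). pure_tensor u (pure_tensor v w) (\<alpha>, \<beta>', \<gamma>')) = (\<lambda>i. u \<alpha> * pure_tensor v w i)"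
    by (auto simp: pure_tensor_def fun_eq_iff)
  moreover have "u \<alpha> = 0 \<or> \<alpha> = \<alpha>\<^sub>1"
    using assms(2) by (auto simp: component_def VA_def)
  ultimately show "op23 X (pure_tensor u (pure_tensor v w)) (\<alpha>, \<beta>, \<gamma>) =
      pure_tensor u (X (tgt \<alpha>\<^sub>1) (pure_tensor v w)) (\<alpha>, \<beta>, \<gamma>)"
    using assms(1)[of "tgt \<alpha>" "u \<alpha>" "pure_tensor v w"]
    by (simp add: op23_def) (auto simp: pure_tensor_def)
qed


section \<open>Matrices on the source fibers of \<open>V \<otimes> V\<close>\<close>

definition eps :: "2 \<Rightarrow> complex" where
  "eps i = (if i = 1 then 1 else -1)"

text \<open>
  \<open>\<complex>\<^sup>2 \<otimes> \<complex>\<^sup>2\<close> is \<open>complex ^ (2 \<times> 2)\<close>, with \<open>e\<^sub>i \<otimes> e\<^sub>j = axis (i, j) 1\<close>. The next two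
  maps are the mutually inverse identifications with the source fiber at \<open>a\<close>.
\<close>

definition fiber_coords ::
    "complex \<Rightarrow> complex \<Rightarrow> (arrow \<times> arrow \<Rightarrow> complex) \<Rightarrow> complex ^ (2 \<times> 2)" where
  "fiber_coords b a \<phi> = (\<chi> p. \<phi> (step b a (eps (fst p)), step b (a + eps (fst p)) (eps (snd p))))"

definition fiber_vector ::
    "complex \<Rightarrow> complex \<Rightarrow> complex ^ (2 \<times> 2) \<Rightarrow> (arrow \<times> arrow \<Rightarrow> complex)" where
  "fiber_vector b a x = (\<lambda>(\<alpha>, \<beta>). \<Sum>p\<in>UNIV. x $ p *
     of_bool (\<alpha> = step b a (eps (fst p)) \<and> \<beta> = step b (a + eps (fst p)) (eps (snd p))))"

definition fiber_op :: "complex \<Rightarrow> complex \<Rightarrow> complex ^ (2 \<times> 2) ^ (2 \<times> 2) \<Rightarrow>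
    (arrow \<times> arrow \<Rightarrow> complex) \<Rightarrow> (arrow \<times> arrow \<Rightarrow> complex)" where
  "fiber_op b a M \<phi> = fiber_vector b a (M *v fiber_coords b a \<phi>)"

definition E :: "2 \<Rightarrow> 2 \<Rightarrow> complex ^ 2 ^ 2" where
  "E i j = (\<chi> k l. of_bool (k = i \<and> l = j))"

definition kron :: "complex ^ 2 ^ 2 \<Rightarrow> complex ^ 2 ^ 2 \<Rightarrow> complex ^ (2 \<times> 2) ^ (2 \<times> 2)"
    (infixr "\<otimes>\<^sub>K" 75) where
  "A \<otimes>\<^sub>K B = (\<chi> p q. A $ fst p $ fst q * B $ snd p $ snd q)"

definition smat :: "complex \<Rightarrow> complex ^ 'n ^ 'm \<Rightarrow> complex ^ 'n ^ 'm" (infixr "*\<^sub>M" 72) where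
  "c *\<^sub>M A = (\<chi> i j. c * A $ i $ j)"


section \<open>The trigonometric solution\<close>

definition brak :: "nat \<Rightarrow> complex \<Rightarrow> complex" where
  "brak L z = sin (complex_of_real pi * z / of_nat (L + 1))"

definition kappa_tri :: "nat \<Rightarrow> complex" where
  "kappa_tri L = complex_of_real (2 * cos (pi / real (L + 1)))"

definition f_tri :: "nat \<Rightarrow> complex \<Rightarrow> complex" where
  "f_tri L z = brak L z / brak L (1 - z)"

text \<open>
  The function \<open>r\<close> is a choice of the complex square roots: \<open>r a\<close> stands for the square root of
  \<open>\<langle>a-1\<rangle>\<langle>a+1\<rangle>\<close>.
\<close>

definition T_mat :: "nat \<Rightarrow> (complex \<Rightarrow> complex) \<Rightarrow> complex \<Rightarrow> complex ^ (2 \<times> 2) ^ (2 \<times> 2)" where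
  "T_mat L r a =
     (r a / brak L a) *\<^sub>M (E 2 1 \<otimes>\<^sub>K E 1 2 + E 1 2 \<otimes>\<^sub>K E 2 1)
     + (brak L (a + 1) / brak L a) *\<^sub>M (E 1 1 \<otimes>\<^sub>K E 2 2)
     + (brak L (a - 1) / brak L a) *\<^sub>M (E 2 2 \<otimes>\<^sub>K E 1 1)"

definition T_tri :: "nat \<Rightarrow> complex \<Rightarrow> (complex \<Rightarrow> complex) \<Rightarrow>
    complex \<Rightarrow> (arrow \<times> arrow \<Rightarrow> complex) \<Rightarrow> (arrow \<times> arrow \<Rightarrow> complex)" where
  "T_tri L b r a = fiber_op b a (T_mat L r a)"

definition R_tri :: "nat \<Rightarrow> complex \<Rightarrow> (complex \<Rightarrow> complex) \<Rightarrow> complex \<Rightarrow>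
    complex \<Rightarrow> (arrow \<times> arrow \<Rightarrow> complex) \<Rightarrow> (arrow \<times> arrow \<Rightarrow> complex)" where
  "R_tri L b r z a \<phi> = (\<lambda>i. \<phi> i + brak L z / brak L (1 - z) * T_tri L b r a \<phi> i)"

end

theory Submission
  imports Defs
begin

text \<open>
  The braiding is \<open>id + f(z) T\<close>, and everything rests on the operators \<open>A = T\<^sup>(\<^sup>1\<^sup>2\<^sup>)\<close> and
  \<open>B = T\<^sup>(\<^sup>2\<^sup>3\<^sup>)\<close> satisfying, on the source fiber at \<open>a\<close>, the Temperley--Lieb relations
  \<open>A\<^sup>2 = \<kappa> A\<close>, \<open>B\<^sup>2 = \<kappa> B\<close>, \<open>A B A = A\<close> and \<open>B A B = B\<close>. Given these, both sides of
  the Yang--Baxter equation with coefficients \<open>x = f(w)\<close>, \<open>x' = f(z)\<close>, \<open>x'' = f(z - w)\<close> expand into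
  the words \<open>1, A, B, AB, BA\<close>, and they agree as soon as
  \<open>x + x'' + \<kappa> x x'' + x x' x'' = x'\<close> (\<open>yang_baxter_of_temperley_lieb\<close>). This is the difference
  formula for \<open>f\<close> with the denominator cleared. The formula itself follows from two
  trigonometric identities, one for its numerator and one for its denominator, in which
  \<open>\<langle>1\<rangle>\<close> appears as a common nonzero factor.

  The relations are checked in coordinates. The operator \<open>T(a)\<close> vanishes on the two straight paths
  and acts on the span of the closed paths \<open>a, a+1, a\<close> and \<open>a, a-1, a\<close>, where its matrix has
  determinant \<open>0\<close>, since the square of the off-diagonal entry is \<open>\<langle>a-1\<rangle>\<langle>a+1\<rangle>/\<langle>a\<rangle>\<^sup>2\<close>, and trace
  \<open>(\<langle>a+1\<rangle> + \<langle>a-1\<rangle>)/\<langle>a\<rangle> = \<kappa>\<close>. By Cayley--Hamilton \<open>T(a)\<^sup>2 = \<kappa> T(a)\<close>. The two cubic relations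
  follow from rank one and from the fact that the diagonal entries \<open>\<langle>a\<plusminus>1\<rangle>/\<langle>a\<rangle>\<close> of \<open>T(a)\<close> and
  \<open>\<langle>a\<rangle>/\<langle>a\<plusminus>1\<rangle>\<close> of \<open>T(a\<plusminus>1)\<close> are inverse to each other.

  The groupoid enters in two ways. Sources and targets survive the deletion of backtracks, so an
  edge is recovered from its arrow and the paths of length \<open>3\<close> from \<open>a\<close> are a basis of the fiber.
  Moreover both closed paths above represent the identity arrow at \<open>a\<close>, so \<open>T(a)\<close>, which mixes them,
  respects the grading.
\<close>

section \<open>Arrows of the groupoid\<close>

lemma equivclp_invariant:
  assumes "equivclp R x y" and "\<And>u v. R u v \<Longrightarrow> f u = f v"
  shows "f x = f y"
  using assms(1) by (induction rule: equivclp_induct) (use assms(2) in metis)+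

lemma backtrack_walk: "backtrack b p q \<Longrightarrow> walk b q"
  by (auto simp: backtrack_def walk_def successively_append_iff successively_Cons)

lemma equivclp_backtrack_walk:
  "equivclp (backtrack b) p q \<Longrightarrow> walk b p \<longleftrightarrow> walk b q"
  by (erule equivclp_invariant) (meson backtrack_walk backtrack_def)

lemma equivclp_backtrack_hd:
  "equivclp (backtrack b) p q \<Longrightarrow> hd p = hd q"
  by (erule equivclp_invariant) (auto simp: backtrack_def hd_append)

lemma equivclp_backtrack_last:
  "equivclp (backtrack b) p q \<Longrightarrow> last p = last q"
  by (erule equivclp_invariant) (auto simp: backtrack_def)

lemma self_in_walk_class: "p \<in> walk_class b p"
  by (simp add: walk_class_def)

lemma walk_class_eqI:
  assumes "equivclp (backtrack b) p q"
  shows "walk_class b p = walk_class b q"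
  unfolding walk_class_def
  using equivclp_trans[OF assms] equivclp_trans[OF equivclp_sym[OF assms]] by blast

lemma src_walk_class [simp]: "src (walk_class b p) = hd p"
proof -
  have "hd ` walk_class b p = {hd p}"
    using self_in_walk_class[of p b] by (auto simp: walk_class_def dest: equivclp_backtrack_hd)
  then show ?thesis by (simp add: src_def)
qed

lemma tgt_walk_class [simp]: "tgt (walk_class b p) = last p"
proof -
  have "last ` walk_class b p = {last p}"
    using self_in_walk_class[of p b] by (auto simp: walk_class_def dest: equivclp_backtrack_last)
  then show ?thesis by (simp add: tgt_def)
qed

lemma walk_append:
  assumes "walk b p" "walk b q" "last p = hd q"
  shows "walk b (p @ tl q)"
  using assms by (cases q) (auto simp: walk_def successively_append_iff successively_Cons)

lemma append_tl_eq_butlast_append: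
  "p \<noteq> [] \<Longrightarrow> q \<noteq> [] \<Longrightarrow> last p = hd q \<Longrightarrow> p @ tl q = butlast p @ q"
  by (metis append_Cons append_Nil append_assoc append_butlast_last_id list.collapse)

lemma backtrack_append_right:
  assumes "backtrack b p p'" "walk b (p @ q)"
  shows "backtrack b (p @ q) (p' @ q)"
  using assms unfolding backtrack_def by (metis append_assoc)

lemma backtrack_append_left:
  assumes "backtrack b q q'" "walk b (p @ q)"
  shows "backtrack b (p @ q) (p @ q')"
  using assms unfolding backtrack_def by (metis append_assoc)

text \<open>
  Composition of walks respects homotopy because a deletion inside one factor is a deletion inside
  the concatenation. Only the vertex shared by the two walks needs care: a deletion in \<open>q\<close> may
  involve it, so for the right factor it is counted as part of \<open>q\<close> and removed from \<open>p\<close>.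
\<close>

lemma equivclp_backtrack_append:
  assumes "equivclp (backtrack b) p p'" "equivclp (backtrack b) q q'"
    and w: "walk b p" "walk b q" "last p = hd q"
  shows "equivclp (backtrack b) (p @ tl q) (p' @ tl q')"
proof -
  have 1: "equivclp (backtrack b) (p @ tl q) (p' @ tl q)"
    using assms(1)
  proof (induction rule: equivclp_induct)
    case (step u v)
    have uv: "walk b u" "walk b v" "last u = hd q" "last v = hd q"
      using step w equivclp_backtrack_walk equivclp_backtrack_last equivclp_into_equivclp
      by metis+
    then have "walk b (u @ tl q)" "walk b (v @ tl q)"
      using w by (auto intro: walk_append)
    then have "equivclp (backtrack b) (u @ tl q) (v @ tl q)"
      using step(2) by (meson backtrack_append_right equivclp_sym r_into_equivclp)
    with step.IH show ?case by (rule equivclp_trans)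
  qed simp
  have p': "walk b p'" "last p' = hd q"
    using assms equivclp_backtrack_walk equivclp_backtrack_last by metis+
  have "equivclp (backtrack b) (butlast p' @ q) (butlast p' @ q')"
    using assms(2)
  proof (induction rule: equivclp_induct)
    case (step u v)
    have uv: "walk b u" "walk b v" "last p' = hd u" "last p' = hd v"
      using step w p' equivclp_backtrack_walk equivclp_backtrack_hd equivclp_into_equivclp
      by metis+
    then have "walk b (butlast p' @ u)" "walk b (butlast p' @ v)"
      using walk_append[of b p'] append_tl_eq_butlast_append[of p'] p'
      by (metis walk_def)+
    then have "equivclp (backtrack b) (butlast p' @ u) (butlast p' @ v)"
      using step(2) by (meson backtrack_append_left equivclp_sym r_into_equivclp)
    with step.IH show ?case by (rule equivclp_trans)
  qed simp
  moreover have "p' @ tl q = butlast p' @ q" "p' @ tl q' = butlast p' @ q'"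
    using assms p' equivclp_backtrack_walk equivclp_backtrack_hd append_tl_eq_butlast_append
    by (metis walk_def)+
  ultimately show ?thesis using 1 equivclp_trans by metis
qed

lemma arrow_comp_walk_class:
  assumes "walk b p" "walk b q" "last p = hd q"
  shows "arrow_comp b (walk_class b q) (walk_class b p) = walk_class b (p @ tl q)"
proof -
  have "walk_class b (p' @ tl q') = walk_class b (p @ tl q)"
    if "p' \<in> walk_class b p" "q' \<in> walk_class b q" for p' q'
    using that equivclp_backtrack_append[OF _ _ assms] walk_class_eqI
    by (metis (no_types, lifting) mem_Collect_eq walk_class_def)
  then show ?thesis
    unfolding arrow_comp_def using self_in_walk_class by blast
qed

lemma vert_add1: "a \<in> vert b \<Longrightarrow> a + 1 \<in> vert b"
proof -
  assume "a \<in> vert b"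
  then obtain n where "a = of_int n + b" by (auto simp: vert_def)
  then have "a + 1 = of_int (n + 1) + b" by simp
  then show ?thesis unfolding vert_def by blast
qed

lemma vert_minus1: "a \<in> vert b \<Longrightarrow> a - 1 \<in> vert b"
proof -
  assume "a \<in> vert b"
  then obtain n where "a = of_int n + b" by (auto simp: vert_def)
  then have "a - 1 = of_int (n - 1) + b" by simp
  then show ?thesis unfolding vert_def by blast
qed

lemma vert_neighbour: "a \<in> vert b \<Longrightarrow> \<epsilon> \<in> {1, -1} \<Longrightarrow> a + \<epsilon> \<in> vert b"
  using vert_add1[of a b] vert_minus1[of a b] by auto

lemma walk_edge: "a \<in> vert b \<Longrightarrow> \<epsilon> \<in> {1, -1} \<Longrightarrow> walk b [a, a + \<epsilon>]"
  using vert_neighbour[of a b \<epsilon>] by (auto simp: walk_def)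

lemma src_step [simp]: "src (step b a \<epsilon>) = a"
  and tgt_step [simp]: "tgt (step b a \<epsilon>) = a + \<epsilon>"
  by (simp_all add: step_def)

lemma step_eq_iff [simp]: "step b a \<epsilon> = step b a' \<epsilon>' \<longleftrightarrow> a = a' \<and> \<epsilon> = \<epsilon>'"
proof
  assume eq: "step b a \<epsilon> = step b a' \<epsilon>'"
  then have "a = a'" by (metis src_step)
  moreover have "a + \<epsilon> = a' + \<epsilon>'" using eq by (metis tgt_step)
  ultimately show "a = a' \<and> \<epsilon> = \<epsilon>'" by simp
qed simp

lemma arrow_comp_step:
  assumes "a \<in> vert b" "\<epsilon> \<in> {1, -1}" "\<delta> \<in> {1, -1}"
  shows "arrow_comp b (step b (a + \<epsilon>) \<delta>) (step b a \<epsilon>) = walk_class b [a, a + \<epsilon>, a + \<epsilon> + \<delta>]"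
  using arrow_comp_walk_class[OF walk_edge walk_edge, of a b \<epsilon> "a + \<epsilon>" \<delta>] assms vert_neighbour[of a b \<epsilon>]
  by (simp add: step_def)

text \<open>
  Both closed paths of length \<open>2\<close> at \<open>a\<close> thus have the same degree, so an operator that mixes them
  can be homogeneous.
\<close>

lemma arrow_comp_back_and_forth:
  assumes "a \<in> vert b" "\<epsilon> \<in> {1, -1}"
  shows "arrow_comp b (step b (a + \<epsilon>) (- \<epsilon>)) (step b a \<epsilon>) = walk_class b [a]"
proof -
  have "walk b [a, a + \<epsilon>, a]"
    using assms vert_neighbour[OF assms] by (auto simp: walk_def)
  then have "backtrack b [a, a + \<epsilon>, a] [a]"
    unfolding backtrack_def by (metis append_Nil append_Nil2)
  then have "walk_class b [a, a + \<epsilon>, a] = walk_class b [a]"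
    by (intro walk_class_eqI r_into_equivclp)
  moreover have "- \<epsilon> \<in> {1, -1}" using assms(2) by auto
  ultimately show ?thesis using arrow_comp_step[OF assms, of "- \<epsilon>"] by simp
qed

text \<open>
  Composability forces the three edges of a basis label to form a path, and the source of the
  composite is where that path starts. So vectors of the fiber live on the eight paths from \<open>a\<close>.
\<close>

lemma VA3_fiber_support:
  assumes "\<phi> \<in> source_fiber (VA3 b) a" "\<phi> (\<alpha>, \<beta>, \<gamma>) \<noteq> 0"
  obtains \<epsilon> \<delta> \<eta> where "\<epsilon> \<in> {1, -1}" "\<delta> \<in> {1, -1}" "\<eta> \<in> {1, -1}"
    "\<alpha> = step b a \<epsilon>" "\<beta> = step b (a + \<epsilon>) \<delta>" "\<gamma> = step b (a + \<epsilon> + \<delta>) \<eta>"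
proof -
  have L: "(\<alpha>, \<beta>, \<gamma>) \<in> labels (VA3 b)" and S: "src (degree_of (VA3 b) (\<alpha>, \<beta>, \<gamma>)) = a"
    using assms by (auto simp: source_fiber_def)
  obtain x \<epsilon> y \<delta> z \<eta> where s: "\<alpha> = step b x \<epsilon>" "\<beta> = step b y \<delta>" "\<gamma> = step b z \<eta>"
    "x \<in> vert b" "y \<in> vert b" "z \<in> vert b" and e: "\<epsilon> \<in> {1, -1}" "\<delta> \<in> {1, -1}" "\<eta> \<in> {1, -1}"
    and z: "y + \<delta> = z" and c: "x + \<epsilon> = src (arrow_comp b \<gamma> \<beta>)"
    using L unfolding graded_tensor_def VA_def by auto
  have bc: "arrow_comp b \<gamma> \<beta> = walk_class b [y, y + \<delta>, y + \<delta> + \<eta>]"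
    using arrow_comp_step[of y b \<delta> \<eta>] s e z by simp
  then have y: "y = x + \<epsilon>" using c by simp
  have "walk b [y, y + \<delta>, y + \<delta> + \<eta>]"
    using walk_append[OF walk_edge walk_edge, of y b \<delta> "y + \<delta>" \<eta>] s e z by simp
  then have "arrow_comp b (arrow_comp b \<gamma> \<beta>) \<alpha> = walk_class b ([x, x + \<epsilon>] @ [y + \<delta>, y + \<delta> + \<eta>])"
    using arrow_comp_walk_class[OF walk_edge, of x b \<epsilon> "[y, y + \<delta>, y + \<delta> + \<eta>]"] bc s e y
    by (simp add: step_def)
  then have "x = a" using S by (simp add: graded_tensor_def VA_def)
  with s e y z that show thesis by blast
qed

section \<open>Trigonometric identities\<close>

lemma kappa_tri_complex: "kappa_tri L = 2 * cos (complex_of_real pi / of_nat (L + 1))"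
  by (simp add: kappa_tri_def cos_of_real[symmetric])

lemma brak_1_nonzero:
  assumes "L \<ge> 2"
  shows "brak L 1 \<noteq> 0"
proof -
  have "0 < pi / real (L + 1)" "pi / real (L + 1) < pi"
    using assms by (simp_all add: field_simps)
  then have "sin (pi / real (L + 1)) > 0" by (rule sin_gt_zero)
  moreover have "brak L 1 = complex_of_real (sin (pi / real (L + 1)))"
    by (simp add: brak_def sin_of_real[symmetric])
  ultimately show ?thesis by simp
qed

lemma brak_eq_sin: "brak L z = sin (complex_of_real pi / of_nat (L + 1) * z)"
  by (simp add: brak_def)

lemma brak_neighbours: "brak L (a + 1) + brak L (a - 1) = kappa_tri L * brak L a"
  unfolding brak_eq_sin kappa_tri_complex
  by (simp only: ring_distribs right_diff_distrib sin_add sin_diff) simp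

text \<open>
  Numerator and denominator of the difference formula, multiplied by \<open>\<langle>1-z\<rangle>\<langle>1-z'\<rangle>\<close>, both contain
  the factor \<open>\<langle>1\<rangle>\<close>, which cancels in the quotient.
\<close>

lemma f_tri_numerator:
  "brak L z' * brak L (1 - z) - brak L z * brak L (1 - z') = brak L 1 * brak L (z' - z)"
  unfolding brak_eq_sin right_diff_distrib sin_diff by algebra

lemma f_tri_denominator:
  "brak L (1 - z) * brak L (1 - z') + kappa_tri L * brak L z * brak L (1 - z') + brak L z * brak L z'
     = brak L 1 * brak L (1 - (z' - z))"
proof -
  let ?t = "complex_of_real pi / of_nat (L + 1)"
  have "sin (?t * 1) * sin (?t * 1) + cos (?t * 1) * cos (?t * 1) = 1"
    using sin_cos_squared_add[of "?t * 1"] unfolding power2_eq_square .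
  moreover have "kappa_tri L = 2 * cos (?t * 1)" by (simp add: kappa_tri_complex)
  ultimately show ?thesis
    unfolding brak_eq_sin right_diff_distrib sin_diff cos_diff by algebra
qed

lemma f_tri_difference:
  assumes "L \<ge> 2" "brak L (1 - z) \<noteq> 0" "brak L (1 - z') \<noteq> 0" "brak L (1 - (z' - z)) \<noteq> 0"
  shows "1 + kappa_tri L * f_tri L z + f_tri L z * f_tri L z' \<noteq> 0" (is "?D \<noteq> 0")
    and "f_tri L (z' - z) = (f_tri L z' - f_tri L z) / (1 + kappa_tri L * f_tri L z + f_tri L z * f_tri L z')"
proof -
  let ?P = "brak L (1 - z) * brak L (1 - z')"
  have D: "?D = brak L 1 * brak L (1 - (z' - z)) / ?P"
    unfolding f_tri_denominator[symmetric] f_tri_def using assms by (simp add: divide_simps ring_distribs)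
  have N: "f_tri L z' - f_tri L z = brak L 1 * brak L (z' - z) / ?P"
    unfolding f_tri_numerator[symmetric] f_tri_def using assms by (simp add: divide_simps)
  show "?D \<noteq> 0" using D assms brak_1_nonzero by simp
  show "f_tri L (z' - z) = (f_tri L z' - f_tri L z) / ?D"
    unfolding D N using assms brak_1_nonzero by (simp add: f_tri_def)
qed

section \<open>The Temperley--Lieb relations\<close>

text \<open>
  The \<open>2 \<times> 2\<close> block of \<open>T(a)\<close> on the two closed paths, in the form used for all later
  computations. The vertex \<open>a\<close> is arbitrary: in \<^const>\<open>op23\<close> it is the target of an arrow that
  need not be an edge.
\<close>

lemma T_tri_apply:
  "T_tri L b r a \<psi> (\<alpha>, \<beta>) =
     of_bool (\<alpha> = step b a 1 \<and> \<beta> = step b (a + 1) (- 1)) *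
       ((brak L (a + 1) * \<psi> (step b a 1, step b (a + 1) (- 1))
         + r a * \<psi> (step b a (- 1), step b (a - 1) 1)) / brak L a)
     + of_bool (\<alpha> = step b a (- 1) \<and> \<beta> = step b (a - 1) 1) *
       ((r a * \<psi> (step b a 1, step b (a + 1) (- 1))
         + brak L (a - 1) * \<psi> (step b a (- 1), step b (a - 1) 1)) / brak L a)"
proof -
  have S: "sum f (UNIV :: (2 \<times> 2) set) = f (1,1) + f (1,2) + f (2,1) + f (2,2)" for f :: "_ \<Rightarrow> complex"
  proof -
    have U: "(UNIV :: (2 \<times> 2) set) = {(1,1),(1,2),(2,1),(2,2)}"
      using exhaust_2 by (auto simp: UNIV_Times_UNIV[symmetric] UNIV_2 simp del: UNIV_Times_UNIV)
    show ?thesis by (subst U) (simp add: add.assoc)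
  qed
  have "T_mat L r a *v x = (\<chi> p. if p = (1,2) then (brak L (a + 1) * x $ (1,2) + r a * x $ (2,1)) / brak L a
      else if p = (2,1) then (r a * x $ (1,2) + brak L (a - 1) * x $ (2,1)) / brak L a else 0)" for x
    unfolding vec_eq_iff split_paired_All forall_2 matrix_vector_mult_def vec_lambda_beta S
    by (simp add: T_mat_def smat_def kron_def E_def add_divide_distrib)
  then show ?thesis
    unfolding T_tri_def fiber_op_def fiber_vector_def case_prod_conv S
    by (simp add: fiber_coords_def eps_def)
qed

lemma T_tri_linear:
  "T_tri L b r a (\<lambda>i. \<phi> i + c * \<psi> i) = (\<lambda>i. T_tri L b r a \<phi> i + c * T_tri L b r a \<psi> i)"
  by (rule ext) (clarsimp simp: T_tri_apply add_divide_distrib algebra_simps)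

text \<open>
  Cayley--Hamilton for a block of determinant \<open>0\<close> and trace \<open>\<kappa>\<close>, written out in entries.
\<close>

lemma T_tri_square:
  assumes "brak L a \<noteq> 0" "(r a)\<^sup>2 = brak L (a - 1) * brak L (a + 1)"
  shows "T_tri L b r a (T_tri L b r a \<psi>) = (\<lambda>i. kappa_tri L * T_tri L b r a \<psi> i)"
proof (rule ext, clarify)
  fix \<alpha> \<beta>
  let ?s = "brak L a" and ?p = "brak L (a + 1)" and ?q = "brak L (a - 1)"
  have "(?p * ((?p * u + r a * v) / ?s) + r a * ((r a * u + ?q * v) / ?s)) / ?s
      = kappa_tri L * ((?p * u + r a * v) / ?s)"
    and "(r a * ((?p * u + r a * v) / ?s) + ?q * ((r a * u + ?q * v) / ?s)) / ?s
      = kappa_tri L * ((r a * u + ?q * v) / ?s)" for u v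
  proof -
    have "?p * (?p * u + r a * v) + r a * (r a * u + ?q * v) = kappa_tri L * ?s * (?p * u + r a * v)"
      "r a * (?p * u + r a * v) + ?q * (r a * u + ?q * v) = kappa_tri L * ?s * (r a * u + ?q * v)"
      unfolding brak_neighbours[symmetric] using assms(2) by algebra+
    then show "(?p * ((?p * u + r a * v) / ?s) + r a * ((r a * u + ?q * v) / ?s)) / ?s
        = kappa_tri L * ((?p * u + r a * v) / ?s)"
      "(r a * ((?p * u + r a * v) / ?s) + ?q * ((r a * u + ?q * v) / ?s)) / ?s
        = kappa_tri L * ((r a * u + ?q * v) / ?s)"
      using assms(1) by (simp_all add: add_divide_distrib[symmetric])
  qed
  then show "T_tri L b r a (T_tri L b r a \<psi>) (\<alpha>, \<beta>) = kappa_tri L * T_tri L b r a \<psi> (\<alpha>, \<beta>)"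
    by (simp add: T_tri_apply)
qed

lemma op12_T_linear:
  "op12 (T_tri L b r) a (\<lambda>i. \<phi> i + c * \<psi> i) =
     (\<lambda>i. op12 (T_tri L b r) a \<phi> i + c * op12 (T_tri L b r) a \<psi> i)"
  by (rule ext) (simp add: op12_def T_tri_linear case_prod_unfold)

lemma op23_T_linear:
  "op23 (T_tri L b r) (\<lambda>i. \<phi> i + c * \<psi> i) =
     (\<lambda>i. op23 (T_tri L b r) \<phi> i + c * op23 (T_tri L b r) \<psi> i)"
  by (rule ext) (simp add: op23_def T_tri_linear case_prod_unfold)

lemma op12_T_square:
  assumes "brak L a \<noteq> 0" "(r a)\<^sup>2 = brak L (a - 1) * brak L (a + 1)"
  shows "op12 (T_tri L b r) a (op12 (T_tri L b r) a \<phi>) = (\<lambda>i. kappa_tri L * op12 (T_tri L b r) a \<phi> i)"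
  by (rule ext) (simp add: op12_def case_prod_unfold T_tri_square[where r = r, OF assms])

lemma op23_T_square:
  assumes "\<phi> \<in> source_fiber (VA3 b) a"
    and "\<And>\<epsilon>. \<epsilon> \<in> {1, -1} \<Longrightarrow> brak L (a + \<epsilon>) \<noteq> 0"
    and "\<And>\<epsilon>. \<epsilon> \<in> {1, -1} \<Longrightarrow> (r (a + \<epsilon>))\<^sup>2 = brak L (a + \<epsilon> - 1) * brak L (a + \<epsilon> + 1)"
  shows "op23 (T_tri L b r) (op23 (T_tri L b r) \<phi>) = (\<lambda>i. kappa_tri L * op23 (T_tri L b r) \<phi> i)"
proof (rule ext, clarify)
  fix \<alpha> \<beta> \<gamma>
  \<comment> \<open>Nothing is known about \<open>\<langle>tgt \<alpha>\<rangle>\<close> unless \<open>\<alpha>\<close> is an edge from \<open>a\<close>; otherwise the vector vanishes there.\<close>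
  consider \<epsilon> where "\<epsilon> \<in> {1, -1}" "\<alpha> = step b a \<epsilon>" | "\<And>\<beta> \<gamma>. \<phi> (\<alpha>, \<beta>, \<gamma>) = 0"
    using VA3_fiber_support[OF assms(1)] by metis
  then show "op23 (T_tri L b r) (op23 (T_tri L b r) \<phi>) (\<alpha>, \<beta>, \<gamma>)
      = kappa_tri L * op23 (T_tri L b r) \<phi> (\<alpha>, \<beta>, \<gamma>)"
  proof cases
    case 1
    show ?thesis
      using T_tri_square[of L _ r, OF assms(2,3), OF 1(1) 1(1)]
      by (simp add: op23_def 1(2) case_prod_unfold)
  next
    case 2
    then show ?thesis by (simp add: op23_def T_tri_apply)
  qed
qed

text \<open>
  Let the last edge be \<open>(a, \<epsilon>)\<close>. Of the two paths produced by the inner \<open>T(a)\<close>, the middle operator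
  kills the one starting with \<open>-\<epsilon>\<close>, whose last two edges run in the same direction. It sends the other
  one, \<open>(\<epsilon>, -\<epsilon>, \<epsilon>)\<close>, to \<open>\<langle>a\<rangle>/\<langle>a+\<epsilon>\<rangle>\<close> times itself plus a multiple of \<open>(\<epsilon>, \<epsilon>, -\<epsilon>)\<close>, which the outer
  \<open>T(a)\<close> kills. Since \<open>T(a)\<close> has rank one, going through the path \<open>(\<epsilon>, -\<epsilon>)\<close> contributes \<open>T(a)\<close> times
  its diagonal entry \<open>\<langle>a+\<epsilon>\<rangle>/\<langle>a\<rangle>\<close>, which cancels the factor.
\<close>

lemma op12_op23_op12_T:
  assumes "\<phi> \<in> source_fiber (VA3 b) a"
    and "brak L a \<noteq> 0" "brak L (a + 1) \<noteq> 0" "brak L (a - 1) \<noteq> 0"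
    and "(r a)\<^sup>2 = brak L (a - 1) * brak L (a + 1)"
  shows "op12 (T_tri L b r) a (op23 (T_tri L b r) (op12 (T_tri L b r) a \<phi>)) = op12 (T_tri L b r) a \<phi>"
proof (rule ext, clarify)
  fix \<alpha> \<beta> \<gamma>
  consider "\<gamma> = step b a 1" | "\<gamma> = step b a (- 1)" | "\<gamma> \<noteq> step b a 1" "\<gamma> \<noteq> step b a (- 1)" by blast
  then show "op12 (T_tri L b r) a (op23 (T_tri L b r) (op12 (T_tri L b r) a \<phi>)) (\<alpha>, \<beta>, \<gamma>)
      = op12 (T_tri L b r) a \<phi> (\<alpha>, \<beta>, \<gamma>)"
  proof cases
    case 1
    then show ?thesis
      using assms by (simp add: op12_def op23_def T_tri_apply field_simps power2_eq_square)
  next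
    case 2
    then show ?thesis
      using assms by (simp add: op12_def op23_def T_tri_apply field_simps power2_eq_square)
  next
    case 3
    \<comment> \<open>A closed path at the vertex \<open>a\<close> can only be continued by an edge from \<open>a\<close>.\<close>
    have "\<phi> (step b a \<epsilon>, step b (a + \<epsilon>) (- \<epsilon>), \<gamma>) = 0" for \<epsilon>
    proof (rule ccontr)
      assume "\<phi> (step b a \<epsilon>, step b (a + \<epsilon>) (- \<epsilon>), \<gamma>) \<noteq> 0"
      then show False
        by (rule VA3_fiber_support[OF assms(1)]) (use 3 in auto)
    qed
    from this[of 1] this[of "- 1"]
    show ?thesis using 3 by (simp add: op12_def op23_def T_tri_apply)
  qed
qed

text \<open>
  The same mechanism with the roles exchanged: if the first edge is \<open>(a, \<epsilon>)\<close>, only the path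
  \<open>(\<epsilon>, -\<epsilon>, \<epsilon>)\<close> contributes in the middle, and it does so with \<open>\<langle>a+\<epsilon>\<rangle>/\<langle>a\<rangle>\<close>.
\<close>

lemma op23_op12_op23_T:
  assumes "\<phi> \<in> source_fiber (VA3 b) a"
    and "brak L a \<noteq> 0" "brak L (a + 1) \<noteq> 0" "brak L (a - 1) \<noteq> 0"
    and "(r (a + 1))\<^sup>2 = brak L a * brak L (a + 2)"
    and "(r (a - 1))\<^sup>2 = brak L (a - 2) * brak L a"
  shows "op23 (T_tri L b r) (op12 (T_tri L b r) a (op23 (T_tri L b r) \<phi>)) = op23 (T_tri L b r) \<phi>"
proof (rule ext, clarify)
  fix \<alpha> \<beta> \<gamma>
  consider "\<alpha> = step b a 1" | "\<alpha> = step b a (- 1)" | "\<alpha> \<noteq> step b a 1" "\<alpha> \<noteq> step b a (- 1)" by blast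
  then show "op23 (T_tri L b r) (op12 (T_tri L b r) a (op23 (T_tri L b r) \<phi>)) (\<alpha>, \<beta>, \<gamma>)
      = op23 (T_tri L b r) \<phi> (\<alpha>, \<beta>, \<gamma>)"
  proof cases
    case 1
    then show ?thesis
      using assms by (simp add: op12_def op23_def T_tri_apply field_simps power2_eq_square)
  next
    case 2
    then show ?thesis
      using assms by (simp add: op12_def op23_def T_tri_apply field_simps power2_eq_square)
  next
    case 3
    have "\<phi> (\<alpha>, \<beta>, \<gamma>) = 0" for \<beta> \<gamma>
      using 3 VA3_fiber_support[OF assms(1), of \<alpha> \<beta> \<gamma>] by blast
    then show ?thesis using 3 by (simp add: op12_def op23_def T_tri_apply)
  qed
qed

section \<open>Homogeneity\<close>

text \<open>
  The image lies in the span of the two closed paths, whose degree is the identity arrow at \<open>a\<close>. In any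
  other degree \<open>T(a)\<close> vanishes.
\<close>

lemma T_tri_preserves_component:
  assumes "a \<in> vert b" "\<psi> \<in> component (VA2 b) \<gamma>"
  shows "T_tri L b r a \<psi> \<in> component (VA2 b) \<gamma>"
proof -
  let ?p = "(step b a 1, step b (a + 1) (- 1))" and ?q = "(step b a (- 1), step b (a - 1) 1)"
  have deg: "degree_of (VA2 b) ?p = walk_class b [a]" "degree_of (VA2 b) ?q = walk_class b [a]"
    using arrow_comp_back_and_forth[OF assms(1), of 1] arrow_comp_back_and_forth[OF assms(1), of "- 1"]
    by (simp_all add: graded_tensor_def VA_def)
  have lab: "?p \<in> labels (VA2 b)" "?q \<in> labels (VA2 b)"
    using assms(1) vert_add1[OF assms(1)] vert_minus1[OF assms(1)]
    by (auto simp: graded_tensor_def VA_def)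
  have sup: "{i. T_tri L b r a \<psi> i \<noteq> 0} \<subseteq> {?p, ?q}"
  proof -
    have "T_tri L b r a \<psi> i = 0" if "i \<notin> {?p, ?q}" for i
      using that by (cases i) (simp add: T_tri_apply, blast)
    then show ?thesis by blast
  qed
  show ?thesis
  proof (cases "\<gamma> = walk_class b [a]")
    case True
    have "finite {i. T_tri L b r a \<psi> i \<noteq> 0}"
      using sup by (rule finite_subset) simp
    moreover have "{?p, ?q} \<subseteq> {i \<in> labels (VA2 b). degree_of (VA2 b) i = \<gamma>}"
      using deg lab True by blast
    ultimately show ?thesis
      unfolding component_def using sup by blast
  next
    case False
    then have "\<psi> ?p = 0" "\<psi> ?q = 0"
      using assms(2) deg unfolding component_def by blast+
    then have "T_tri L b r a \<psi> = (\<lambda>_. 0)"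
      by (auto simp: T_tri_apply fun_eq_iff)
    then show ?thesis by (simp add: component_def)
  qed
qed

lemma component_add_scaled:
  assumes "\<phi> \<in> component V \<gamma>" "\<psi> \<in> component V \<gamma>"
  shows "(\<lambda>i. \<phi> i + c * \<psi> i) \<in> component V \<gamma>"
proof -
  have "{i. \<phi> i + c * \<psi> i \<noteq> 0} \<subseteq> {i. \<phi> i \<noteq> 0} \<union> {i. \<psi> i \<noteq> 0}" by auto
  with assms show ?thesis unfolding component_def by (auto intro: finite_subset)
qed

lemma R_tri_fiber_End: "R_tri L b r z \<in> fiber_End b (VA2 b)"
proof -
  have R: "R_tri L b r z a = (\<lambda>\<phi> i. \<phi> i + f_tri L z * T_tri L b r a \<phi> i)" for a
    by (intro ext) (simp add: R_tri_def f_tri_def)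
  have add: "T_tri L b r a (\<lambda>i. \<phi> i + \<psi> i) = (\<lambda>i. T_tri L b r a \<phi> i + T_tri L b r a \<psi> i)" for a \<phi> \<psi>
    using T_tri_linear[of L b r a \<phi> 1 \<psi>] by simp
  have zero: "T_tri L b r a (\<lambda>i. 0) = (\<lambda>i. 0)" for a
    by (auto simp: T_tri_apply fun_eq_iff)
  have scale: "T_tri L b r a (\<lambda>i. c * \<psi> i) = (\<lambda>i. c * T_tri L b r a \<psi> i)" for a c \<psi>
    using T_tri_linear[of L b r a "\<lambda>_. 0" c \<psi>] by (simp add: zero)
  show ?thesis
    unfolding fiber_End_def R
    by (auto simp: add scale ring_distribs mult.left_commute
        intro!: component_add_scaled T_tri_preserves_component)
qed

section \<open>The Yang--Baxter equation\<close>

text \<open>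
  Both sides become combinations of \<open>1, A, B, AB, BA\<close> because the relations reduce every longer word.
  The words \<open>AB\<close> and \<open>BA\<close> get equal coefficients on the two sides, and comparing those of \<open>A\<close> and \<open>B\<close>
  gives the single condition on \<open>x, y, z\<close>. The relations are assumed at a single vector \<open>\<phi>\<close>,
  since \<open>T\<^sup>(\<^sup>1\<^sup>2\<^sup>)\<close> and \<open>T\<^sup>(\<^sup>2\<^sup>3\<^sup>)\<close> satisfy all four on the source fiber but not on
  arbitrary coefficient functions.
\<close>

lemma yang_baxter_of_temperley_lieb:
  fixes A B :: "('i \<Rightarrow> complex) \<Rightarrow> 'i \<Rightarrow> complex"
  assumes A: "\<And>\<phi> \<psi> c. A (\<lambda>i. \<phi> i + c * \<psi> i) = (\<lambda>i. A \<phi> i + c * A \<psi> i)"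
    and B: "\<And>\<phi> \<psi> c. B (\<lambda>i. \<phi> i + c * \<psi> i) = (\<lambda>i. B \<phi> i + c * B \<psi> i)"
    and AA: "A (A \<phi>) = (\<lambda>i. k * A \<phi> i)" and BB: "B (B \<phi>) = (\<lambda>i. k * B \<phi> i)"
    and ABA: "A (B (A \<phi>)) = A \<phi>" and BAB: "B (A (B \<phi>)) = B \<phi>"
    and xyz: "x + y + k * x * y + x * y * z = z"
  defines "RA \<equiv> \<lambda>c \<phi> i. \<phi> i + c * A \<phi> i" and "RB \<equiv> \<lambda>c \<phi> i. \<phi> i + c * B \<phi> i"
  shows "RB y (RA z (RB x \<phi>)) = RA x (RB z (RA y \<phi>))"
proof
  fix i
  have "RB y (RA z (RB x \<phi>)) i = \<phi> i + (x + y + k * x * y + x * y * z) * B \<phi> i + z * A \<phi> i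
      + x * z * A (B \<phi>) i + y * z * B (A \<phi>) i"
    unfolding RA_def RB_def A B BB BAB by (simp add: algebra_simps)
  moreover have "RA x (RB z (RA y \<phi>)) i = \<phi> i + (x + y + k * x * y + x * y * z) * A \<phi> i + z * B \<phi> i
      + x * z * A (B \<phi>) i + y * z * B (A \<phi>) i"
    unfolding RA_def RB_def A B AA ABA by (simp add: algebra_simps)
  ultimately show "RB y (RA z (RB x \<phi>)) i = RA x (RB z (RA y \<phi>)) i"
    unfolding xyz by simp
qed

lemma op12_R: "op12 (R_tri L b r z) a \<phi> = (\<lambda>i. \<phi> i + f_tri L z * op12 (T_tri L b r) a \<phi> i)"
  by (rule ext) (simp add: op12_def R_tri_def f_tri_def case_prod_unfold)

lemma op23_R: "op23 (R_tri L b r z) \<phi> = (\<lambda>i. \<phi> i + f_tri L z * op23 (T_tri L b r) \<phi> i)"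
  by (rule ext) (simp add: op23_def R_tri_def f_tri_def case_prod_unfold)

lemma yang_baxter_R_tri:
  assumes L: "L \<ge> 2" and a: "a \<in> vert b"
    and nz: "\<forall>a \<in> vert b. brak L a \<noteq> 0"
    and sqrt: "\<forall>a \<in> vert b. (r a)\<^sup>2 = brak L (a - 1) * brak L (a + 1)"
    and z: "brak L (1 - z) \<noteq> 0" "brak L (1 - w) \<noteq> 0" "brak L (1 - (z - w)) \<noteq> 0"
    and \<phi>: "\<phi> \<in> source_fiber (VA3 b) a"
  shows "op23 (R_tri L b r (z - w)) (op12 (R_tri L b r z) a (op23 (R_tri L b r w) \<phi>)) =
    op12 (R_tri L b r w) a (op23 (R_tri L b r z) (op12 (R_tri L b r (z - w)) a \<phi>))"
proof -
  have v: "a + 1 \<in> vert b" "a - 1 \<in> vert b"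
    using vert_add1[OF a] vert_minus1[OF a] .
  have nb: "a + \<epsilon> \<in> vert b" if "\<epsilon> \<in> {1, -1}" for \<epsilon>
    using vert_neighbour[OF a that] .
  have "f_tri L (z - w) * (1 + kappa_tri L * f_tri L w + f_tri L w * f_tri L z) = f_tri L z - f_tri L w"
    using f_tri_difference[OF L z(2,1,3)] by simp
  then have "f_tri L w + f_tri L (z - w) + kappa_tri L * f_tri L w * f_tri L (z - w)
      + f_tri L w * f_tri L (z - w) * f_tri L z = f_tri L z"
    by algebra
  moreover have "(r (a + 1))\<^sup>2 = brak L a * brak L (a + 2)" "(r (a - 1))\<^sup>2 = brak L (a - 2) * brak L a"
    using sqrt[rule_format, OF v(1)] sqrt[rule_format, OF v(2)] by (simp_all add: algebra_simps)
  ultimately show ?thesis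
    unfolding op12_R op23_R
    by (intro yang_baxter_of_temperley_lieb[where k = "kappa_tri L"]
        op12_T_linear op23_T_linear op12_T_square op23_T_square op12_op23_op12_T op23_op12_op23_T)
       (use nz sqrt a v nb \<phi> in auto)
qed

theorem lemma2p27:
  fixes L :: nat and b :: complex and r :: "complex \<Rightarrow> complex"
  assumes "L \<ge> 2"
    and "\<forall>a \<in> vert b. brak L a \<noteq> 0"
    and "\<forall>a \<in> vert b. (r a)\<^sup>2 = brak L (a - 1) * brak L (a + 1)"
  shows "(\<forall>z z'. brak L (1 - z) \<noteq> 0 \<and> brak L (1 - z') \<noteq> 0 \<and> brak L (1 - (z' - z)) \<noteq> 0 \<longrightarrow>
           1 + kappa_tri L * f_tri L z + f_tri L z * f_tri L z' \<noteq> 0 \<and>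
           f_tri L (z' - z) =
             (f_tri L z' - f_tri L z) / (1 + kappa_tri L * f_tri L z + f_tri L z * f_tri L z'))
       \<and> (\<forall>z. brak L (1 - z) \<noteq> 0 \<longrightarrow> R_tri L b r z \<in> fiber_End b (VA2 b))
       \<and> (\<forall>a \<in> vert b. \<forall>z w.
           brak L (1 - z) \<noteq> 0 \<and> brak L (1 - w) \<noteq> 0 \<and> brak L (1 - (z - w)) \<noteq> 0 \<longrightarrow>
           (\<forall>\<phi> \<in> source_fiber (VA3 b) a.
              op23 (R_tri L b r (z - w)) (op12 (R_tri L b r z) a (op23 (R_tri L b r w) \<phi>)) =
              op12 (R_tri L b r w) a (op23 (R_tri L b r z) (op12 (R_tri L b r (z - w)) a \<phi>))))"
  using f_tri_difference[OF assms(1)] R_tri_fiber_End yang_baxter_R_tri[OF assms(1) _ assms(2,3)]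
  by blast

end
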